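(* Let $\mathscr{S} = (S,\theta,s^{\circ})$ be a feature transition system and let $s,t \in S$. Then $s$ and $t$ are branching feature bisimilar with respect to $\mathscr{S}$ (i.e. $s \simeq_{bf} t$) if and only if, for every product $P \in \mathscr{P}$, $s$ and $t$ are branching bisimilar states of the projected labeled transition system $\mathscr{S}_P$.
   Context: Fix a finite non-empty set $\mathscr{F}$ of features, a set of products $\mathscr{P} \subseteq 2^{\mathscr{F}}$, a set of actions $\mathscr{A}$, a silent action $\tau \notin \mathscr{A}$, and $\mathscr{A}_\tau = \mathscr{A} \cup \{\tau\}$. $\mathbb{B}(\mathscr{F})$ denotes the set of Boolean expressions over $\mathscr{F}$ (feature expressions). For $P \in \mathscr{P}$ and $\varphi \in \mathbb{B}(\mathscr{F})$, $P \models \varphi$ means $\varphi$ evaluates to true when features in $P$ are set true and the others false. $\varphi \sim_{\mathscr{P}} \psi$ iff for all $P\in\mathscr{P}$, $P\models\varphi \Leftrightarrow P\models\psi$; $\widehat{\mathbb{B}(\mathscr{F})} = \mathbb{B}(\mathscr{F})/{\sim_{\mathscr{P}}}$ and $\hat\varphi$ is the class of $\varphi$. A feature transition system (FTS) is $\mathscr{S}=(S,\theta,s^\circ)$ with state set $S$, transition constraint function $\theta : S\times\mathscr{A}_\tau\times S \to \mathbb{B}(\mathscr{F})$ and initial state $s^\circ\in S$. Write $s \xrightarrow{\alpha|\psi} s'$ if $\theta(s,\alpha,s')=\psi$ and $\psi$ is satisfiable. Write $s \Rightarrow_{\eta} s'$ ($\eta$ satisfiable) if there are $n\ge 0$, states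 $s=s_0,\dots,s_n=s'$ and $\eta_1,\dots,\eta_n$ with $s_{i-1}\xrightarrow{\tau|\eta_i} s_i$ for all $i$ and $\eta=\bigwedge_{i}\eta_i$. Write $s \xrightarrow{(\alpha|\psi)} s'$ if $s\xrightarrow{\alpha|\psi}s'$, or $\alpha=\tau$, $s=s'$ and $\psi=\mathit{true}$. A symmetric relation $R\subseteq S\times\widehat{\mathbb{B}(\mathscr{F})}\times S$ is a branching feature bisimulation relation for $\mathscr{S}$ if whenever $R(s,\hat\varphi,t)$ and $s\xrightarrow{\alpha|\psi}s'$, there exist $n$ and, for $i=1,\dots,n$, states $\hat t_i,t'_i$ and feature expressions $\eta_i,\psi_i,\varphi_i,\varphi'_i$ such that $t\Rightarrow_{\eta_i}\hat t_i\xrightarrow{(\alpha|\psi_i)} t'_i$, $R(s,\hat\varphi_i,\hat t_i)$, $R(s',\hat\varphi'_i,t'_i)$ for all $i$, and for all $P\in\mathscr{P}$: $P\models\varphi\wedge\psi$ implies $P\models\bigvee_{1\le i\le n}(\eta_i\wedge\psi_i\wedge\varphi_i\wedge\varphi'_i)$. States $s,t$ are branching feature bisimilar, $s\simeq_{bf} t$, if $R(s,\widehat{\mathit{true}},t)$ for some such $R$. For $P\in\mathscr{P}$, the projection $\mathscr{S}_P$ is the labeled transition system $(S,\to_P,s^\circ)$ where $s\xrightarrow{\alpha}_P s'$ iff $s\xrightarrow{\alpha|\psi}s'$ for some $\psi$ with $P\models\psi$. For a labeled transition system $(S,\to,s^\circ)$ over $\mathscr{A}_\tau$: $s\Rightarrow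 s'$ means $s$ reaches $s'$ by zero or more $\tau$-transitions; $\hat t\xrightarrow{(\alpha)}t'$ means $\hat t\xrightarrow{\alpha}t'$ or ($\alpha=\tau$ and $\hat t=t'$); a symmetric $R\subseteq S\times S$ is a branching bisimulation if whenever $R(s,t)$ and $s\xrightarrow{\alpha}s'$, there are $\hat t,t'$ with $t\Rightarrow\hat t\xrightarrow{(\alpha)}t'$, $R(s,\hat t)$ and $R(s',t')$; $s,t$ are branching bisimilar if $R(s,t)$ for some such $R$. *)

theory Defs
  imports Main
begin

datatype (features: 'f) fexp =
    FTrue
  | FFalse
  | Feature 'f
  | FNot "'f fexp"
  | FAnd "'f fexp" "'f fexp"
  | FOr "'f fexp" "'f fexp"

primrec models :: "'f set \<Rightarrow> 'f fexp \<Rightarrow> bool" (infix "\<Turnstile>" 50) where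
  "P \<Turnstile> FTrue \<longleftrightarrow> True"
| "P \<Turnstile> FFalse \<longleftrightarrow> False"
| "P \<Turnstile> Feature f \<longleftrightarrow> f \<in> P"
| "P \<Turnstile> FNot \<phi> \<longleftrightarrow> \<not> P \<Turnstile> \<phi>"
| "P \<Turnstile> FAnd \<phi> \<psi> \<longleftrightarrow> P \<Turnstile> \<phi> \<and> P \<Turnstile> \<psi>"
| "P \<Turnstile> FOr \<phi> \<psi> \<longleftrightarrow> P \<Turnstile> \<phi> \<or> P \<Turnstile> \<psi>"

definition fconj :: "'f fexp list \<Rightarrow> 'f fexp" where
  "fconj \<phi>s = foldr FAnd \<phi>s FTrue"

definition fdisj :: "'f fexp list \<Rightarrow> 'f fexp" where
  "fdisj \<phi>s = foldr FOr \<phi>s FFalse"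

text \<open>Satisfiability is by an arbitrary truth assignment, not necessarily by a product.\<close>

definition satisfiable :: "'f fexp \<Rightarrow> bool" where
  "satisfiable \<phi> \<longleftrightarrow> (\<exists>X. X \<Turnstile> \<phi>)"

definition fexps :: "'f set \<Rightarrow> 'f fexp set" where
  "fexps F = {\<phi>. features \<phi> \<subseteq> F}"

definition fequiv :: "'f set \<Rightarrow> 'f set set \<Rightarrow> 'f fexp rel" where
  "fequiv F Prods =
    {(\<phi>, \<psi>). \<phi> \<in> fexps F \<and> \<psi> \<in> fexps F \<and> (\<forall>P\<in>Prods. P \<Turnstile> \<phi> \<longleftrightarrow> P \<Turnstile> \<psi>)}"

definition fclass :: "'f set \<Rightarrow> 'f set set \<Rightarrow> 'f fexp \<Rightarrow> 'f fexp set" where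
  "fclass F Prods \<phi> = fequiv F Prods `` {\<phi>}"

text \<open>
  Throughout, \<open>F\<close> is the set of features, \<open>Prods\<close> the set of products, \<open>A\<close> the set of
  (visible) actions and \<open>\<tau>\<close> the silent action, so that \<open>insert \<tau> A\<close> is the set of all labels.
  The constraint function of a feature transition system is only meaningful on
  states and labels in these carriers.
\<close>

record ('s, 'a, 'f) fts =
  fts_states :: "'s set"
  fts_constraint :: "'s \<Rightarrow> 'a \<Rightarrow> 's \<Rightarrow> 'f fexp"
  fts_init :: 's

record ('s, 'a) lts =
  lts_states :: "'s set"
  lts_trans :: "'s \<Rightarrow> 'a \<Rightarrow> 's \<Rightarrow> bool"
  lts_init :: 's

definition is_fts :: "'f set \<Rightarrow> 'a set \<Rightarrow> 'a \<Rightarrow> ('s, 'a, 'f) fts \<Rightarrow> bool" where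
  "is_fts F A \<tau> \<S> \<longleftrightarrow>
    (\<forall>s\<in>fts_states \<S>. \<forall>\<alpha>\<in>insert \<tau> A. \<forall>s'\<in>fts_states \<S>. fts_constraint \<S> s \<alpha> s' \<in> fexps F) \<and>
    fts_init \<S> \<in> fts_states \<S>"

definition fts_step ::
  "'a set \<Rightarrow> 'a \<Rightarrow> ('s, 'a, 'f) fts \<Rightarrow> 's \<Rightarrow> 'a \<Rightarrow> 'f fexp \<Rightarrow> 's \<Rightarrow> bool" where
  "fts_step A \<tau> \<S> s \<alpha> \<psi> s' \<longleftrightarrow>
    s \<in> fts_states \<S> \<and> \<alpha> \<in> insert \<tau> A \<and> s' \<in> fts_states \<S> \<and>
    fts_constraint \<S> s \<alpha> s' = \<psi> \<and> satisfiable \<psi>"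

definition fts_silent ::
  "'a set \<Rightarrow> 'a \<Rightarrow> ('s, 'a, 'f) fts \<Rightarrow> 's \<Rightarrow> 'f fexp \<Rightarrow> 's \<Rightarrow> bool" where
  "fts_silent A \<tau> \<S> s \<eta> s' \<longleftrightarrow>
    satisfiable \<eta> \<and>
    (\<exists>n (\<sigma> :: nat \<Rightarrow> 's) (\<eta>s :: nat \<Rightarrow> 'f fexp).
      \<sigma> 0 = s \<and> \<sigma> n = s' \<and>
      (\<forall>i\<in>{1..n}. fts_step A \<tau> \<S> (\<sigma> (i - 1)) \<tau> (\<eta>s i) (\<sigma> i)) \<and>
      \<eta> = fconj (map \<eta>s [1..<Suc n]))"

definition fts_opt_step ::
  "'a set \<Rightarrow> 'a \<Rightarrow> ('s, 'a, 'f) fts \<Rightarrow> 's \<Rightarrow> 'a \<Rightarrow> 'f fexp \<Rightarrow> 's \<Rightarrow> bool" where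
  "fts_opt_step A \<tau> \<S> s \<alpha> \<psi> s' \<longleftrightarrow>
    fts_step A \<tau> \<S> s \<alpha> \<psi> s' \<or> (\<alpha> = \<tau> \<and> s = s' \<and> \<psi> = FTrue)"

definition branching_feature_bisimulation ::
  "'f set \<Rightarrow> 'f set set \<Rightarrow> 'a set \<Rightarrow> 'a \<Rightarrow> ('s, 'a, 'f) fts \<Rightarrow>
    ('s \<times> 'f fexp set \<times> 's) set \<Rightarrow> bool" where
  "branching_feature_bisimulation F Prods A \<tau> \<S> R \<longleftrightarrow>
    R \<subseteq> fts_states \<S> \<times> (fexps F // fequiv F Prods) \<times> fts_states \<S> \<and>
    (\<forall>s c t. (s, c, t) \<in> R \<longrightarrow> (t, c, s) \<in> R) \<and>
    (\<forall>s t s' \<alpha> \<psi>. \<forall>\<phi>\<in>fexps F.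
      (s, fclass F Prods \<phi>, t) \<in> R \<and> fts_step A \<tau> \<S> s \<alpha> \<psi> s' \<longrightarrow>
      (\<exists>(n :: nat) t\<^sub>1 t\<^sub>2 \<eta> \<psi>' \<phi>\<^sub>1 \<phi>\<^sub>2.
        (\<forall>i\<in>{1..n}.
          fts_silent A \<tau> \<S> t (\<eta> i) (t\<^sub>1 i) \<and>
          fts_opt_step A \<tau> \<S> (t\<^sub>1 i) \<alpha> (\<psi>' i) (t\<^sub>2 i) \<and>
          \<phi>\<^sub>1 i \<in> fexps F \<and> (s, fclass F Prods (\<phi>\<^sub>1 i), t\<^sub>1 i) \<in> R \<and>
          \<phi>\<^sub>2 i \<in> fexps F \<and> (s', fclass F Prods (\<phi>\<^sub>2 i), t\<^sub>2 i) \<in> R) \<and>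
        (\<forall>P\<in>Prods. P \<Turnstile> FAnd \<phi> \<psi> \<longrightarrow>
          P \<Turnstile> fdisj (map (\<lambda>i. fconj [\<eta> i, \<psi>' i, \<phi>\<^sub>1 i, \<phi>\<^sub>2 i]) [1..<Suc n]))))"

definition branching_feature_bisimilar ::
  "'f set \<Rightarrow> 'f set set \<Rightarrow> 'a set \<Rightarrow> 'a \<Rightarrow> ('s, 'a, 'f) fts \<Rightarrow> 's \<Rightarrow> 's \<Rightarrow> bool" where
  "branching_feature_bisimilar F Prods A \<tau> \<S> s t \<longleftrightarrow>
    (\<exists>R. branching_feature_bisimulation F Prods A \<tau> \<S> R \<and> (s, fclass F Prods FTrue, t) \<in> R)"

definition projection ::
  "'a set \<Rightarrow> 'a \<Rightarrow> ('s, 'a, 'f) fts \<Rightarrow> 'f set \<Rightarrow> ('s, 'a) lts" where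
  "projection A \<tau> \<S> P =
    \<lparr> lts_states = fts_states \<S>,
      lts_trans = (\<lambda>s \<alpha> s'. \<exists>\<psi>. fts_step A \<tau> \<S> s \<alpha> \<psi> s' \<and> P \<Turnstile> \<psi>),
      lts_init = fts_init \<S> \<rparr>"

definition lts_silent :: "'a \<Rightarrow> ('s, 'a) lts \<Rightarrow> 's \<Rightarrow> 's \<Rightarrow> bool" where
  "lts_silent \<tau> L = (\<lambda>s s'. lts_trans L s \<tau> s')\<^sup>*\<^sup>*"

definition lts_opt_step :: "'a \<Rightarrow> ('s, 'a) lts \<Rightarrow> 's \<Rightarrow> 'a \<Rightarrow> 's \<Rightarrow> bool" where
  "lts_opt_step \<tau> L s \<alpha> s' \<longleftrightarrow> lts_trans L s \<alpha> s' \<or> (\<alpha> = \<tau> \<and> s = s')"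

definition branching_bisimulation :: "'a \<Rightarrow> ('s, 'a) lts \<Rightarrow> 's rel \<Rightarrow> bool" where
  "branching_bisimulation \<tau> L R \<longleftrightarrow>
    R \<subseteq> lts_states L \<times> lts_states L \<and> sym R \<and>
    (\<forall>s t s' \<alpha>. (s, t) \<in> R \<and> lts_trans L s \<alpha> s' \<longrightarrow>
      (\<exists>t\<^sub>1 t\<^sub>2. lts_silent \<tau> L t t\<^sub>1 \<and> lts_opt_step \<tau> L t\<^sub>1 \<alpha> t\<^sub>2 \<and>
        (s, t\<^sub>1) \<in> R \<and> (s', t\<^sub>2) \<in> R))"

definition branching_bisimilar :: "'a \<Rightarrow> ('s, 'a) lts \<Rightarrow> 's \<Rightarrow> 's \<Rightarrow> bool" where
  "branching_bisimilar \<tau> L s t \<longleftrightarrow> (\<exists>R. branching_bisimulation \<tau> L R \<and> (s, t) \<in> R)"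

end

theory Submission
  imports Defs
begin

text \<open>
  From left to right, a branching feature bisimulation \<open>R\<close> yields for each product \<open>P\<close> the
  branching bisimulation of all pairs that \<open>R\<close> relates under an expression true in \<open>P\<close>.
  From right to left, relate two states under \<open>\<phi>\<close> whenever they are branching bisimilar in
  \<open>\<S>\<^sub>P\<close> for all products \<open>P\<close> satisfying \<open>\<phi>\<close>. As there are only finitely many
  products, a step can be matched product by product, with the expression that characterises
  the product as the condition on each of the matching branches.
\<close>

section \<open>Semantics of feature expressions and of their classes\<close>

lemma models_fconj: "P \<Turnstile> fconj \<phi>s \<longleftrightarrow> (\<forall>\<phi>\<in>set \<phi>s. P \<Turnstile> \<phi>)"
  by (induction \<phi>s) (auto simp: fconj_def)

lemma models_fdisj: "P \<Turnstile> fdisj \<phi>s \<longleftrightarrow> (\<exists>\<phi>\<in>set \<phi>s. P \<Turnstile> \<phi>)"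
  by (induction \<phi>s) (auto simp: fdisj_def)

lemma features_fconj: "features (fconj \<phi>s) = (\<Union>\<phi>\<in>set \<phi>s. features \<phi>)"
  by (induction \<phi>s) (auto simp: fconj_def)

text \<open>The minterm of \<open>P\<close>, a literal for every feature in \<open>F\<close>, fixes
  an assignment on \<open>F\<close>. It says nothing about features outside \<open>F\<close>, hence
  the restriction to \<open>Q \<subseteq> F\<close>.\<close>

lemma ex_characteristic_fexp:
  assumes "finite F" and "P \<subseteq> F"
  obtains \<chi> where "\<chi> \<in> fexps F" and "\<And>Q. Q \<subseteq> F \<Longrightarrow> Q \<Turnstile> \<chi> \<longleftrightarrow> Q = P"
proof -
  obtain fs where fs: "set fs = F"
    using finite_list[OF assms(1)] by blast
  let ?\<chi> = "fconj (map (\<lambda>f. if f \<in> P then Feature f else FNot (Feature f)) fs)"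
  show thesis
  proof
    show "?\<chi> \<in> fexps F"
      using fs by (auto simp: fexps_def features_fconj)
    show "Q \<Turnstile> ?\<chi> \<longleftrightarrow> Q = P" if "Q \<subseteq> F" for Q
    proof -
      have "Q \<Turnstile> ?\<chi> \<longleftrightarrow> (\<forall>f\<in>F. f \<in> Q \<longleftrightarrow> f \<in> P)"
        using fs by (auto simp: models_fconj simp del: if_image_distrib)
      then show ?thesis
        using that assms(2) by blast
    qed
  qed
qed

text \<open>Makes truth in a product a property of the class. Reflexivity of \<open>fequiv\<close>
  on \<open>fexps F\<close> puts \<open>\<psi>\<close> into its own class, which is also that of
  \<open>\<phi>\<close>.\<close>

lemma models_cong_fclass:
  assumes "fclass F Prods \<phi> = fclass F Prods \<psi>" and "\<psi> \<in> fexps F" and "P \<in> Prods"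
  shows "P \<Turnstile> \<phi> \<longleftrightarrow> P \<Turnstile> \<psi>"
proof -
  have "\<psi> \<in> fclass F Prods \<phi>"
    using assms(1,2) by (simp add: fclass_def fequiv_def)
  then show ?thesis
    using assms(3) by (simp add: fclass_def fequiv_def)
qed

lemma fclass_in_quotient: "\<phi> \<in> fexps F \<Longrightarrow> fclass F Prods \<phi> \<in> fexps F // fequiv F Prods"
  by (simp add: fclass_def quotientI)

section \<open>Silent paths and optional steps of the projections\<close>

lemma lts_silent_projection_iff:
  "lts_silent \<tau> (projection A \<tau> \<S> P) s s' \<longleftrightarrow> (\<exists>\<eta>. fts_silent A \<tau> \<S> s \<eta> s' \<and> P \<Turnstile> \<eta>)"
proof
  let ?step = "\<lambda>s s'. lts_trans (projection A \<tau> \<S> P) s \<tau> s'"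
  assume "lts_silent \<tau> (projection A \<tau> \<S> P) s s'"
  then obtain n where "(?step ^^ n) s s'"
    unfolding lts_silent_def by (auto dest: rtranclp_imp_relpowp)
  then obtain \<sigma> where \<sigma>: "\<sigma> 0 = s" "\<sigma> n = s'" "\<And>i. i < n \<Longrightarrow> ?step (\<sigma> i) (\<sigma> (Suc i))"
    unfolding relpowp_fun_conv by blast
  \<comment> \<open>The steps of the path are numbered from 0 in \<open>relpowp_fun_conv\<close>,
    but from 1 in \<open>fts_silent\<close>.\<close>
  have "\<exists>\<psi>. fts_step A \<tau> \<S> (\<sigma> (i - 1)) \<tau> \<psi> (\<sigma> i) \<and> P \<Turnstile> \<psi>" if "i \<in> {1..n}" for i
    using \<sigma>(3)[of "i - 1"] that by (cases i) (simp_all add: projection_def)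
  then obtain \<eta>s where \<eta>s:
    "\<And>i. i \<in> {1..n} \<Longrightarrow> fts_step A \<tau> \<S> (\<sigma> (i - 1)) \<tau> (\<eta>s i) (\<sigma> i) \<and> P \<Turnstile> \<eta>s i"
    by metis
  let ?\<eta> = "fconj (map \<eta>s [1..<Suc n])"
  have "P \<Turnstile> ?\<eta>"
    using \<eta>s by (auto simp: models_fconj simp del: upt_Suc)
  \<comment> \<open>\<open>fts_silent\<close> demands that the conjunction be satisfiable;
    \<open>P\<close> itself is a satisfying assignment.\<close>
  moreover from this have "fts_silent A \<tau> \<S> s ?\<eta> s'"
    unfolding fts_silent_def satisfiable_def using \<sigma>(1,2) \<eta>s by blast
  ultimately show "\<exists>\<eta>. fts_silent A \<tau> \<S> s \<eta> s' \<and> P \<Turnstile> \<eta>"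
    by blast
next
  let ?step = "\<lambda>s s'. lts_trans (projection A \<tau> \<S> P) s \<tau> s'"
  assume "\<exists>\<eta>. fts_silent A \<tau> \<S> s \<eta> s' \<and> P \<Turnstile> \<eta>"
  then obtain n \<sigma> \<eta>s where \<sigma>: "\<sigma> 0 = s" "\<sigma> n = s'"
    and step: "\<forall>i\<in>{1..n}. fts_step A \<tau> \<S> (\<sigma> (i - 1)) \<tau> (\<eta>s i) (\<sigma> i)"
    and P: "P \<Turnstile> fconj (map \<eta>s [1..<Suc n])"
    unfolding fts_silent_def by blast
  have "?step (\<sigma> i) (\<sigma> (Suc i))" if "i < n" for i
  proof -
    have "P \<Turnstile> \<eta>s (Suc i)"
      using P that by (auto simp: models_fconj simp del: upt_Suc)
    then show ?thesis
      using bspec[OF step, of "Suc i"] that by (auto simp: projection_def)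
  qed
  then have "(?step ^^ n) s s'"
    unfolding relpowp_fun_conv using \<sigma> by blast
  then show "lts_silent \<tau> (projection A \<tau> \<S> P) s s'"
    unfolding lts_silent_def by (rule relpowp_imp_rtranclp)
qed

lemma lts_opt_step_projection_iff:
  "lts_opt_step \<tau> (projection A \<tau> \<S> P) s \<alpha> s' \<longleftrightarrow>
    (\<exists>\<psi>. fts_opt_step A \<tau> \<S> s \<alpha> \<psi> s' \<and> P \<Turnstile> \<psi>)"
  by (auto simp: lts_opt_step_def fts_opt_step_def projection_def)

section \<open>Branching bisimilarity in a single transition system\<close>

lemma branching_bisimilar_in_states:
  assumes "branching_bisimilar \<tau> L s t"
  shows "s \<in> lts_states L" and "t \<in> lts_states L"
  using assms by (auto simp: branching_bisimilar_def branching_bisimulation_def)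

lemma branching_bisimilar_sym: "branching_bisimilar \<tau> L s t \<Longrightarrow> branching_bisimilar \<tau> L t s"
  unfolding branching_bisimilar_def branching_bisimulation_def by (meson symD)

text \<open>The relation \<open>R\<close> that witnesses the bisimilarity of \<open>s\<close> and
  \<open>t\<close> also contains both resulting pairs. Hence bisimilarity has the transfer property
  of a branching bisimulation.\<close>

lemma branching_bisimilar_step:
  assumes "branching_bisimilar \<tau> L s t" and "lts_trans L s \<alpha> s'"
  obtains t\<^sub>1 t\<^sub>2 where "lts_silent \<tau> L t t\<^sub>1" and "lts_opt_step \<tau> L t\<^sub>1 \<alpha> t\<^sub>2"
    and "branching_bisimilar \<tau> L s t\<^sub>1" and "branching_bisimilar \<tau> L s' t\<^sub>2"
proof -
  obtain R where R: "branching_bisimulation \<tau> L R" "(s, t) \<in> R"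
    using assms(1) unfolding branching_bisimilar_def by blast
  then obtain t\<^sub>1 t\<^sub>2 where "lts_silent \<tau> L t t\<^sub>1" "lts_opt_step \<tau> L t\<^sub>1 \<alpha> t\<^sub>2"
    "(s, t\<^sub>1) \<in> R" "(s', t\<^sub>2) \<in> R"
    using assms(2) unfolding branching_bisimulation_def by blast
  with R(1) that show thesis
    unfolding branching_bisimilar_def by blast
qed

section \<open>From a branching feature bisimulation to the projections\<close>

lemma branching_bisimulation_projection:
  assumes R: "branching_feature_bisimulation F Prods A \<tau> \<S> R" and "P \<in> Prods"
  shows "branching_bisimulation \<tau> (projection A \<tau> \<S> P)
    {(s, t). \<exists>\<phi>\<in>fexps F. (s, fclass F Prods \<phi>, t) \<in> R \<and> P \<Turnstile> \<phi>}"
    (is "branching_bisimulation \<tau> ?L ?R")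
  unfolding branching_bisimulation_def
proof (intro conjI allI impI)
  show "?R \<subseteq> lts_states ?L \<times> lts_states ?L"
    using R by (auto simp: branching_feature_bisimulation_def projection_def)
  have "\<forall>s c t. (s, c, t) \<in> R \<longrightarrow> (t, c, s) \<in> R"
    using R by (simp add: branching_feature_bisimulation_def)
  then show "sym ?R"
    by (fastforce simp: sym_def)
next
  fix s t s' \<alpha>
  assume "(s, t) \<in> ?R \<and> lts_trans ?L s \<alpha> s'"
  then obtain \<phi> \<psi> where \<phi>: "\<phi> \<in> fexps F" "(s, fclass F Prods \<phi>, t) \<in> R" "P \<Turnstile> \<phi>"
    and \<psi>: "fts_step A \<tau> \<S> s \<alpha> \<psi> s'" "P \<Turnstile> \<psi>"
    by (auto simp: projection_def)
  \<comment> \<open>The transfer condition of \<open>R\<close> offers a family of branches that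
    covers all products satisfying \<open>\<phi>\<close> and \<open>\<psi>\<close> together; only
    the choice of a branch depends on \<open>P\<close>.\<close>
  note R[unfolded branching_feature_bisimulation_def, THEN conjunct2, THEN conjunct2,
      rule_format, OF \<phi>(1) conjI[OF \<phi>(2) \<psi>(1)]]
  then obtain n :: nat and t\<^sub>1 t\<^sub>2 \<eta> \<psi>' \<phi>\<^sub>1 \<phi>\<^sub>2 where
    match: "\<forall>i\<in>{1..n}.
      fts_silent A \<tau> \<S> t (\<eta> i) (t\<^sub>1 i) \<and>
      fts_opt_step A \<tau> \<S> (t\<^sub>1 i) \<alpha> (\<psi>' i) (t\<^sub>2 i) \<and>
      \<phi>\<^sub>1 i \<in> fexps F \<and> (s, fclass F Prods (\<phi>\<^sub>1 i), t\<^sub>1 i) \<in> R \<and>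
      \<phi>\<^sub>2 i \<in> fexps F \<and> (s', fclass F Prods (\<phi>\<^sub>2 i), t\<^sub>2 i) \<in> R"
    and cover: "\<forall>P\<in>Prods. P \<Turnstile> FAnd \<phi> \<psi> \<longrightarrow>
      P \<Turnstile> fdisj (map (\<lambda>i. fconj [\<eta> i, \<psi>' i, \<phi>\<^sub>1 i, \<phi>\<^sub>2 i]) [1..<Suc n])"
    by (elim exE conjE) (rule that)
  have "P \<Turnstile> fdisj (map (\<lambda>i. fconj [\<eta> i, \<psi>' i, \<phi>\<^sub>1 i, \<phi>\<^sub>2 i]) [1..<Suc n])"
    using cover \<open>P \<in> Prods\<close> \<phi>(3) \<psi>(2) by simp
  \<comment> \<open>Some disjunct holds in \<open>P\<close>. Of its conjuncts,
    \<open>\<eta> i\<close> and \<open>\<psi>' i\<close> make the silent path and the optional step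
    available in the projection, and \<open>\<phi>\<^sub>1 i\<close> and
    \<open>\<phi>\<^sub>2 i\<close> put the two pairs into \<open>?R\<close>.\<close>
  then obtain i where i: "i \<in> {1..n}" "P \<Turnstile> \<eta> i" "P \<Turnstile> \<psi>' i" "P \<Turnstile> \<phi>\<^sub>1 i" "P \<Turnstile> \<phi>\<^sub>2 i"
    by (auto simp: models_fdisj models_fconj less_Suc_eq_le simp del: upt_Suc)
  have "lts_silent \<tau> ?L t (t\<^sub>1 i)"
    using match i(1,2) lts_silent_projection_iff by fast
  moreover have "lts_opt_step \<tau> ?L (t\<^sub>1 i) \<alpha> (t\<^sub>2 i)"
    using match i(1,3) lts_opt_step_projection_iff by fast
  moreover have "(s, t\<^sub>1 i) \<in> ?R" "(s', t\<^sub>2 i) \<in> ?R"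
    using match i(1,4,5) by blast+
  ultimately show "\<exists>t\<^sub>1 t\<^sub>2. lts_silent \<tau> ?L t t\<^sub>1 \<and> lts_opt_step \<tau> ?L t\<^sub>1 \<alpha> t\<^sub>2 \<and>
      (s, t\<^sub>1) \<in> ?R \<and> (s', t\<^sub>2) \<in> ?R"
    by blast
qed

section \<open>From the projections to a branching feature bisimulation\<close>

definition productwise_bisimilarity ::
  "'f set \<Rightarrow> 'f set set \<Rightarrow> 'a set \<Rightarrow> 'a \<Rightarrow> ('s, 'a, 'f) fts \<Rightarrow> ('s \<times> 'f fexp set \<times> 's) set" where
  "productwise_bisimilarity F Prods A \<tau> \<S> =
    {(s, fclass F Prods \<phi>, t) | s \<phi> t.
      s \<in> fts_states \<S> \<and> \<phi> \<in> fexps F \<and> t \<in> fts_states \<S> \<and>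
      (\<forall>P\<in>Prods. P \<Turnstile> \<phi> \<longrightarrow> branching_bisimilar \<tau> (projection A \<tau> \<S> P) s t)}"

text \<open>The definition only provides some representative of the class. Equivalent expressions
  hold in the same products, so the condition can be read off at any representative
  \<open>\<phi>\<close>.\<close>

lemma productwise_bisimilarity_iff:
  assumes "\<phi> \<in> fexps F"
  shows "(s, fclass F Prods \<phi>, t) \<in> productwise_bisimilarity F Prods A \<tau> \<S> \<longleftrightarrow>
    s \<in> fts_states \<S> \<and> t \<in> fts_states \<S> \<and>
    (\<forall>P\<in>Prods. P \<Turnstile> \<phi> \<longrightarrow> branching_bisimilar \<tau> (projection A \<tau> \<S> P) s t)"
  unfolding productwise_bisimilarity_def using assms models_cong_fclass by blast

text \<open>For products other than \<open>P\<close> the condition is vacuous, so bisimilarity in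
  one projection suffices to relate two states under \<open>\<chi>\<close>.\<close>

lemma productwise_bisimilarity_characteristic:
  assumes "\<chi> \<in> fexps F" and "\<forall>Q\<in>Prods. Q \<Turnstile> \<chi> \<longrightarrow> Q = P"
    and "branching_bisimilar \<tau> (projection A \<tau> \<S> P) s t"
  shows "(s, fclass F Prods \<chi>, t) \<in> productwise_bisimilarity F Prods A \<tau> \<S>"
  using assms branching_bisimilar_in_states[OF assms(3)]
  by (auto simp: productwise_bisimilarity_iff projection_def)

text \<open>Finiteness of \<open>F\<close> enters twice: it makes each product expressible by a
  characteristic expression, and it bounds the number of products and so of branches.\<close>

lemma branching_feature_bisimulation_productwise:
  assumes "finite F" and "Prods \<subseteq> Pow F"
  shows "branching_feature_bisimulation F Prods A \<tau> \<S> (productwise_bisimilarity F Prods A \<tau> \<S>)"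
    (is "branching_feature_bisimulation _ _ _ _ _ ?R")
  unfolding branching_feature_bisimulation_def
proof (intro conjI allI ballI impI)
  show "?R \<subseteq> fts_states \<S> \<times> (fexps F // fequiv F Prods) \<times> fts_states \<S>"
    by (auto simp: productwise_bisimilarity_def fclass_in_quotient)
  show "(t, c, s) \<in> ?R" if "(s, c, t) \<in> ?R" for s c t
    using that unfolding productwise_bisimilarity_def by (blast intro: branching_bisimilar_sym)
next
  fix s t s' \<alpha> \<psi> \<phi>
  assume \<phi>: "\<phi> \<in> fexps F"
    and "(s, fclass F Prods \<phi>, t) \<in> ?R \<and> fts_step A \<tau> \<S> s \<alpha> \<psi> s'"
  then have rel: "(s, fclass F Prods \<phi>, t) \<in> ?R" and step: "fts_step A \<tau> \<S> s \<alpha> \<psi> s'"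
    by auto
  let ?M = "{P \<in> Prods. P \<Turnstile> FAnd \<phi> \<psi>}"
  \<comment> \<open>The data of one branch that serves the product \<open>P\<close>. The same
    \<open>\<chi>\<close> plays the role of both \<open>\<phi>\<^sub>1\<close> and
    \<open>\<phi>\<^sub>2\<close>, which is why it is repeated in the conjunction.\<close>
  define matches where "matches P t\<^sub>1 t\<^sub>2 \<eta> \<psi>' \<chi> \<longleftrightarrow>
      fts_silent A \<tau> \<S> t \<eta> t\<^sub>1 \<and> fts_opt_step A \<tau> \<S> t\<^sub>1 \<alpha> \<psi>' t\<^sub>2 \<and>
      \<chi> \<in> fexps F \<and> (s, fclass F Prods \<chi>, t\<^sub>1) \<in> ?R \<and> (s', fclass F Prods \<chi>, t\<^sub>2) \<in> ?R \<and>
      P \<Turnstile> fconj [\<eta>, \<psi>', \<chi>, \<chi>]" for P t\<^sub>1 t\<^sub>2 \<eta> \<psi>' \<chi>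
  have "\<exists>t\<^sub>1 t\<^sub>2 \<eta> \<psi>' \<chi>. matches P t\<^sub>1 t\<^sub>2 \<eta> \<psi>' \<chi>" if P: "P \<in> ?M" for P
  proof -
    let ?L = "projection A \<tau> \<S> P"
    have "branching_bisimilar \<tau> ?L s t" and "lts_trans ?L s \<alpha> s'"
      using rel step P \<phi> by (auto simp: productwise_bisimilarity_iff projection_def)
    then obtain t\<^sub>1 t\<^sub>2 where "lts_silent \<tau> ?L t t\<^sub>1" "lts_opt_step \<tau> ?L t\<^sub>1 \<alpha> t\<^sub>2"
      and bis: "branching_bisimilar \<tau> ?L s t\<^sub>1" "branching_bisimilar \<tau> ?L s' t\<^sub>2"
      by (rule branching_bisimilar_step)
    then obtain \<eta> \<psi>' where fts: "fts_silent A \<tau> \<S> t \<eta> t\<^sub>1" "fts_opt_step A \<tau> \<S> t\<^sub>1 \<alpha> \<psi>' t\<^sub>2"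
      and "P \<Turnstile> \<eta>" "P \<Turnstile> \<psi>'"
      by (auto simp: lts_silent_projection_iff lts_opt_step_projection_iff)
    have "P \<subseteq> F"
      using P assms(2) by blast
    then obtain \<chi> where \<chi>: "\<chi> \<in> fexps F" "\<And>Q. Q \<subseteq> F \<Longrightarrow> Q \<Turnstile> \<chi> \<longleftrightarrow> Q = P"
      using ex_characteristic_fexp[OF assms(1)] by blast
    have only_P: "\<forall>Q\<in>Prods. Q \<Turnstile> \<chi> \<longrightarrow> Q = P"
      using \<chi>(2) assms(2) by blast
    have "P \<Turnstile> \<chi>"
      using \<chi>(2) \<open>P \<subseteq> F\<close> by blast
    have "(s, fclass F Prods \<chi>, t\<^sub>1) \<in> ?R" "(s', fclass F Prods \<chi>, t\<^sub>2) \<in> ?R"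
      by (rule productwise_bisimilarity_characteristic[OF \<chi>(1) only_P], fact bis)+
    then have "matches P t\<^sub>1 t\<^sub>2 \<eta> \<psi>' \<chi>"
      using fts \<chi>(1) \<open>P \<Turnstile> \<eta>\<close> \<open>P \<Turnstile> \<psi>'\<close> \<open>P \<Turnstile> \<chi>\<close> by (simp add: matches_def models_fconj)
    then show ?thesis
      by blast
  qed
  \<comment> \<open>Choice turns the branch data into functions of the product.\<close>
  then obtain t\<^sub>1 t\<^sub>2 \<eta> \<psi>' \<chi> where
    match: "\<And>P. P \<in> ?M \<Longrightarrow> matches P (t\<^sub>1 P) (t\<^sub>2 P) (\<eta> P) (\<psi>' P) (\<chi> P)"
    by metis
  have "finite ?M"
    using assms by (auto intro: finite_subset[of _ "Pow F"])
  \<comment> \<open>Branches are indexed by \<open>{1..n}\<close>, so the relevant products are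
    enumerated by \<open>p\<close>. If no product satisfies \<open>\<phi>\<close> and
    \<open>\<psi>\<close> together, then \<open>n = 0\<close> and the covering condition is
    vacuous.\<close>
  then obtain p and n :: nat where p: "p ` {1..n} = ?M"
    using ex_bij_betw_nat_finite_1[of ?M] by (auto simp: bij_betw_def)
  have branches: "\<forall>i\<in>{1..n}.
      fts_silent A \<tau> \<S> t (\<eta> (p i)) (t\<^sub>1 (p i)) \<and>
      fts_opt_step A \<tau> \<S> (t\<^sub>1 (p i)) \<alpha> (\<psi>' (p i)) (t\<^sub>2 (p i)) \<and>
      \<chi> (p i) \<in> fexps F \<and> (s, fclass F Prods (\<chi> (p i)), t\<^sub>1 (p i)) \<in> ?R \<and>
      \<chi> (p i) \<in> fexps F \<and> (s', fclass F Prods (\<chi> (p i)), t\<^sub>2 (p i)) \<in> ?R"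
    using match p unfolding matches_def by blast
  have cover: "\<forall>P\<in>Prods. P \<Turnstile> FAnd \<phi> \<psi> \<longrightarrow>
      P \<Turnstile> fdisj (map (\<lambda>i. fconj [\<eta> (p i), \<psi>' (p i), \<chi> (p i), \<chi> (p i)]) [1..<Suc n])"
  proof (intro ballI impI)
    fix P
    assume "P \<in> Prods" "P \<Turnstile> FAnd \<phi> \<psi>"
    then have "P \<in> ?M"
      by blast
    with p obtain i where "i \<in> {1..n}" "P = p i"
      by (metis (lifting) imageE)
    \<comment> \<open>The branch built for \<open>P\<close> supplies the disjunct that is true in
      \<open>P\<close>.\<close>
    with match[OF \<open>P \<in> ?M\<close>, unfolded matches_def]
    show "P \<Turnstile> fdisj (map (\<lambda>i. fconj [\<eta> (p i), \<psi>' (p i), \<chi> (p i), \<chi> (p i)]) [1..<Suc n])"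
      by (auto simp: models_fdisj simp del: upt_Suc intro!: bexI[of _ i])
  qed
  show "\<exists>(n :: nat) t\<^sub>1 t\<^sub>2 \<eta> \<psi>' \<phi>\<^sub>1 \<phi>\<^sub>2.
      (\<forall>i\<in>{1..n}.
        fts_silent A \<tau> \<S> t (\<eta> i) (t\<^sub>1 i) \<and>
        fts_opt_step A \<tau> \<S> (t\<^sub>1 i) \<alpha> (\<psi>' i) (t\<^sub>2 i) \<and>
        \<phi>\<^sub>1 i \<in> fexps F \<and> (s, fclass F Prods (\<phi>\<^sub>1 i), t\<^sub>1 i) \<in> ?R \<and>
        \<phi>\<^sub>2 i \<in> fexps F \<and> (s', fclass F Prods (\<phi>\<^sub>2 i), t\<^sub>2 i) \<in> ?R) \<and>
      (\<forall>P\<in>Prods. P \<Turnstile> FAnd \<phi> \<psi> \<longrightarrow>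
        P \<Turnstile> fdisj (map (\<lambda>i. fconj [\<eta> i, \<psi>' i, \<phi>\<^sub>1 i, \<phi>\<^sub>2 i]) [1..<Suc n]))"
    by (rule exI[of _ n], rule exI[of _ "\<lambda>i. t\<^sub>1 (p i)"], rule exI[of _ "\<lambda>i. t\<^sub>2 (p i)"],
        rule exI[of _ "\<lambda>i. \<eta> (p i)"], rule exI[of _ "\<lambda>i. \<psi>' (p i)"],
        rule exI[of _ "\<lambda>i. \<chi> (p i)"], rule exI[of _ "\<lambda>i. \<chi> (p i)"], rule conjI[OF branches cover])
qed

theorem theorem6:
  fixes F :: "'f set" and Prods :: "'f set set"
    and A :: "'a set" and \<tau> :: 'a
    and \<S> :: "('s, 'a, 'f) fts" and s t :: 's
  assumes "finite F" and "F \<noteq> {}"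
    and "Prods \<subseteq> Pow F"
    and "\<tau> \<notin> A"
    and "is_fts F A \<tau> \<S>"
    and "s \<in> fts_states \<S>" and "t \<in> fts_states \<S>"
  shows "branching_feature_bisimilar F Prods A \<tau> \<S> s t \<longleftrightarrow>
    (\<forall>P\<in>Prods. branching_bisimilar \<tau> (projection A \<tau> \<S> P) s t)"
proof
  have true: "FTrue \<in> fexps F"
    by (simp add: fexps_def)
  show "\<forall>P\<in>Prods. branching_bisimilar \<tau> (projection A \<tau> \<S> P) s t"
    if bis: "branching_feature_bisimilar F Prods A \<tau> \<S> s t"
  proof
    fix P
    assume "P \<in> Prods"
    from bis obtain R where R: "branching_feature_bisimulation F Prods A \<tau> \<S> R"
      "(s, fclass F Prods FTrue, t) \<in> R"
      unfolding branching_feature_bisimilar_def by blast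
    have "(s, t) \<in> {(s, t). \<exists>\<phi>\<in>fexps F. (s, fclass F Prods \<phi>, t) \<in> R \<and> P \<Turnstile> \<phi>}"
      using R(2) true by (auto intro: bexI[of _ FTrue])
    with branching_bisimulation_projection[OF R(1) \<open>P \<in> Prods\<close>]
    show "branching_bisimilar \<tau> (projection A \<tau> \<S> P) s t"
      unfolding branching_bisimilar_def by (intro exI conjI)
  qed
  show "branching_feature_bisimilar F Prods A \<tau> \<S> s t"
    if "\<forall>P\<in>Prods. branching_bisimilar \<tau> (projection A \<tau> \<S> P) s t"
  proof -
    \<comment> \<open>As \<open>FTrue\<close> holds in every product, membership under its class
      demands bisimilarity in all projections, which is the assumption.\<close>
    have "(s, fclass F Prods FTrue, t) \<in> productwise_bisimilarity F Prods A \<tau> \<S>"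
      using that assms(6,7) true by (simp add: productwise_bisimilarity_iff)
    with branching_feature_bisimulation_productwise[OF assms(1,3)] show ?thesis
      unfolding branching_feature_bisimilar_def by (intro exI conjI)
  qed
qed

end
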